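(* Consider the system $x(t+1)=A_{\mathrm o}x(t)+B_{\mathrm o}u(t)+w(t)$, $y_1(t)=C_1x(t)+D_1u(t)$, $y_2(t)=C_2x(t)+D_2u(t)$, $t\in\mathbb{N}$, with initial state $x(0)$, and let the offline data matrices $X^+,X,U$, the matrices $\Phi_{11},\Phi_{12},\Phi_{22}$, the symmetric matrix $N$, and the constraint bounds $y_{2v,\max}\ge 0$ be as in the context. Let $\sigma_0>0$ and $r_0>0$. Suppose: (a) The offline data satisfy Assumption 1 (stated in the context), and there exists $(\bar A,\bar B)\in\mathbb{R}^{n\times n}\times\mathbb{R}^{n\times m}$ such that $$\begin{bmatrix} I\\ \bar A^{\top}\\ \bar B^{\top}\end{bmatrix}^{\top} N\begin{bmatrix} I\\ \bar A^{\top}\\ \bar B^{\top}\end{bmatrix}\succ 0 .$$ (b) The online disturbance inputs satisfy $\sum_{t=0}^{\infty}\|w(t)\|^2\le\sigma_0$. (c) The tuple $(\eta_0,Q_0,Y_0,\alpha_0,\beta_0)$ is a (feasible) solution of the optimization problem of maximizing $\eta$ over $\eta>0$, $Q=Q^{\top}\in\mathbb{R}^{n\times n}$, $Y\in\mathbb{R}^{m\times n}$, $\alpha\ge0$, $\beta>0$ subject to $$\begin{bmatrix} Q-(\eta+\beta)I & 0&0&0&0\\ 0&0&0&Q&0\\ 0&0&0&Y&0\\ 0&Q&Y^{\top}&Q&(C_1Q+D_1Y)^{\top}\\ 0&0&0&C_1Q+D_1Y&I\end{bmatrix}\succeq\alpha\begin{bmatrix}N&0\\0&0\end{bmatrix},$$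 $$\begin{bmatrix}Q&(C_1Q+D_1Y)^{\top}\\ C_1Q+D_1Y&I\end{bmatrix}\succ0,\qquad \begin{bmatrix}r_0&x(0)^{\top}&1\\ x(0)&Q&0\\1&0&\sigma_0^{-1}\eta\end{bmatrix}\succeq0,$$ $$\begin{bmatrix}y_{2v,\max}^2\,r_0^{-1}&e_v^{\top}(C_2Q+D_2Y)\\(C_2Q+D_2Y)^{\top}e_v&Q\end{bmatrix}\succeq0,\quad v=1,\dots,p_2 .$$ Then, if the system is controlled using $u(t)=K_0x(t)$ for all $t\in\mathbb{N}$, with $K_0=Y_0Q_0^{-1}$, the closed-loop system has the following properties: (i) The matrix $A_{\mathrm c,0}=A_{\mathrm o}+B_{\mathrm o}K_0$ is Schur stable, and the closed-loop $\mathcal{H}_\infty$ norm from $w$ to $y_1$, i.e. the $\mathcal{H}_\infty$ norm of $G_1(z)=(C_1+D_1K_0)(zI-A_{\mathrm c,0})^{-1}$, is less than $\gamma_0=\eta_0^{-1/2}$. (ii) $y_{2v}(t)\le y_{2v,\max}$ for all $v=1,\dots,p_2$ and all $t\in\mathbb{N}$.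
   Context: Setting: $x(t)\in\mathbb{R}^n$ is the state, $u(t)\in\mathbb{R}^m$ the control, $w(t)\in\mathbb{R}^n$ an unmeasured disturbance, $y_1(t)\in\mathbb{R}^{p_1}$, $y_2(t)\in\mathbb{R}^{p_2}$ outputs; all matrices are real, of compatible dimensions. Standing assumptions: $(A_{\mathrm o},B_{\mathrm o})$ is stabilizable and $(C_1,A_{\mathrm o})$ is detectable. $y_{2v}(t)$ is the $v$th entry of $y_2(t)$, $y_{2v,\max}\ge0$ are given bounds, $e_v$ is the $v$th standard basis vector of $\mathbb{R}^{p_2}$, and $\|\cdot\|$ is the Euclidean norm. $\succ,\succeq,\prec,\preceq$ denote the usual (semi)definite orders on symmetric matrices. A square matrix is Schur stable if all its eigenvalues have modulus less than 1; the $\mathcal{H}_\infty$ norm of a stable discrete-time transfer matrix is the supremum over $|z|=1$ of its largest singular value. Offline data: $\{(x_j^+,x_j,u_j)\}_{j=1}^J$ with $x_j^+=A_{\mathrm o}x_j+B_{\mathrm o}u_j+w_j$, where $w_j\in\mathbb{R}^n$ are unknown disturbance values. Set $X^+=[x_1^+,\dots,x_J^+]$, $X=[x_1,\dots,x_J]$, $U=[u_1,\dots,u_J]$, $W=[w_1,\dots,w_J]$, so $W=X^+-A_{\mathrm o}X-B_{\mathrm o}U$. Assumption 1: $$\begin{bmatrix}I\\ W^{\top}\end{bmatrix}^{\top}\begin{bmatrix}\Phi_{11}&\Phi_{12}\\ \Phi_{12}^{\top}&\Phi_{22}\end{bmatrix}\begin{bmatrix}I\\ W^{\top}\end{bmatrix}\succeq0,$$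 where $\Phi_{11}=\Phi_{11}^{\top}\in\mathbb{R}^{n\times n}$, $\Phi_{12}\in\mathbb{R}^{n\times J}$, $\Phi_{22}=\Phi_{22}^{\top}\in\mathbb{R}^{J\times J}$ with $\Phi_{22}\prec0$ are known matrices. Data matrix $N\in\mathbb{R}^{(2n+m)\times(2n+m)}$: the symmetric matrix $$N=\begin{bmatrix}\Theta&\star&\star\\-X\Phi_{12}^{\top}-X\Phi_{22}(X^+)^{\top}&X\Phi_{22}X^{\top}&\star\\-U\Phi_{12}^{\top}-U\Phi_{22}(X^+)^{\top}&U\Phi_{22}X^{\top}&U\Phi_{22}U^{\top}\end{bmatrix},$$ with $\Theta=\Phi_{11}+X^+\Phi_{12}^{\top}+\Phi_{12}(X^+)^{\top}+X^+\Phi_{22}(X^+)^{\top}$, where $\star$ denotes the transpose of the corresponding block below the diagonal. In the first matrix inequality of the optimization problem the blocks have sizes $n,n,m,n,p_1$, and $N$ is padded by zero blocks of sizes $n$ and $p_1$. "Solution" means a feasible point (values of the decision variables satisfying all constraints), not necessarily optimal. *)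

theory Defs
  imports "HOL-Analysis.Analysis"
begin

section \<open>Block matrices\<close>

text \<open>
  Rows and columns of block matrices are indexed by sum types. Both concatenations associate to
  the left, so blocks of sizes \<open>'a\<close>, \<open>'b\<close>, \<open>'c\<close> give the index type \<open>('a + 'b) + 'c\<close>.
\<close>

definition hcat :: "'s ^ 'a ^ 'r \<Rightarrow> 's ^ 'b ^ 'r \<Rightarrow> 's ^ ('a::finite + 'b::finite) ^ 'r"
    (infixl \<open>|||\<close> 60)
  where "M ||| M' = (\<chi> i j. case j of Inl a \<Rightarrow> M $ i $ a | Inr b \<Rightarrow> M' $ i $ b)"

definition vcat :: "'s ^ 'c ^ 'a \<Rightarrow> 's ^ 'c ^ 'b \<Rightarrow> 's ^ 'c ^ ('a::finite + 'b::finite)"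
    (infixl \<open>;;\<close> 55)
  where "M ;; M' = (\<chi> i. case i of Inl a \<Rightarrow> M $ a | Inr b \<Rightarrow> M' $ b)"

text \<open>A scalar as a \<open>1 \<times> 1\<close> block.\<close>

abbreviation scalar_block :: "real \<Rightarrow> real ^ 1 ^ 1"
  where "scalar_block c \<equiv> mat c"

definition of_columns :: "('j \<Rightarrow> 's ^ 'n) \<Rightarrow> 's ^ 'j ^ 'n"
  where "of_columns f = (\<chi> i j. f j $ i)"


section \<open>Definite orders on symmetric matrices\<close>

definition pos_semidef :: "real ^ 'n ^ 'n \<Rightarrow> bool"
  where "pos_semidef M \<longleftrightarrow> transpose M = M \<and> (\<forall>v. 0 \<le> v \<bullet> (M *v v))"

definition pos_def :: "real ^ 'n ^ 'n \<Rightarrow> bool"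
  where "pos_def M \<longleftrightarrow> transpose M = M \<and> (\<forall>v. v \<noteq> 0 \<longrightarrow> 0 < v \<bullet> (M *v v))"

definition semidef_ge :: "real ^ 'n ^ 'n \<Rightarrow> real ^ 'n ^ 'n \<Rightarrow> bool"  (infix \<open>\<succeq>\<close> 50)
  where "M \<succeq> M' \<longleftrightarrow> pos_semidef (M - M')"

definition def_gt :: "real ^ 'n ^ 'n \<Rightarrow> real ^ 'n ^ 'n \<Rightarrow> bool"  (infix \<open>\<succ>\<close> 50)
  where "M \<succ> M' \<longleftrightarrow> pos_def (M - M')"

abbreviation def_lt :: "real ^ 'n ^ 'n \<Rightarrow> real ^ 'n ^ 'n \<Rightarrow> bool"  (infix \<open>\<prec>\<close> 50)
  where "M \<prec> M' \<equiv> M' \<succ> M"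


section \<open>Stability, stabilizability, detectability\<close>

definition mat_eigenvalue :: "complex ^ 'n ^ 'n \<Rightarrow> complex \<Rightarrow> bool"
  where "mat_eigenvalue M z \<longleftrightarrow> (\<exists>v. v \<noteq> 0 \<and> M *v v = z *s v)"

abbreviation complex_mat :: "real ^ 'n ^ 'm \<Rightarrow> complex ^ 'n ^ 'm"
  where "complex_mat \<equiv> map_matrix complex_of_real"

definition schur_stable :: "real ^ 'n ^ 'n \<Rightarrow> bool"
  where "schur_stable A \<longleftrightarrow> (\<forall>z. mat_eigenvalue (complex_mat A) z \<longrightarrow> norm z < 1)"

definition stabilizable :: "real ^ 'n ^ 'n \<Rightarrow> real ^ 'm ^ 'n \<Rightarrow> bool"
  where "stabilizable A B \<longleftrightarrow> (\<exists>K. schur_stable (A + B ** K))"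

definition detectable :: "real ^ 'n ^ 'p \<Rightarrow> real ^ 'n ^ 'n \<Rightarrow> bool"
  where "detectable C A \<longleftrightarrow> (\<exists>L. schur_stable (A + L ** C))"


section \<open>The H-infinity norm\<close>

definition conj_transpose :: "complex ^ 'n ^ 'm \<Rightarrow> complex ^ 'm ^ 'n"
  where "conj_transpose M = transpose (map_matrix cnj M)"

text \<open>
  The set below is finite and nonempty: the eigenvalues of \<open>M\<^sup>* M\<close> are real and nonnegative.
\<close>

definition max_singular_value :: "complex ^ 'n ^ 'm \<Rightarrow> real"
  where "max_singular_value M =
    Max {s. 0 \<le> s \<and> mat_eigenvalue (conj_transpose M ** M) (complex_of_real (s\<^sup>2))}"

text \<open>
  Meant for transfer matrices without poles on the unit circle. The supremum is taken in
  \<^typ>\<open>ereal\<close>, so that it is meaningful whether or not the set is bounded.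
\<close>

definition hinf_norm :: "(complex \<Rightarrow> complex ^ 'n ^ 'm) \<Rightarrow> ereal"
  where "hinf_norm G = (SUP z\<in>{z. norm z = 1}. ereal (max_singular_value (G z)))"

text \<open>The transfer matrix \<open>C (z I - A)\<^sup>-\<^sup>1\<close>; the scalar matrix \<open>z I\<close> is \<^term>\<open>mat z\<close>.\<close>

definition transfer_matrix ::
    "real ^ 'n ^ 'n \<Rightarrow> real ^ 'n ^ 'p \<Rightarrow> complex \<Rightarrow> complex ^ 'n ^ 'p"
  where "transfer_matrix A C z = complex_mat C ** matrix_inv (mat z - complex_mat A)"


section \<open>The data matrix\<close>

definition data_matrix ::
    "real ^ 'n ^ 'n \<Rightarrow> real ^ 'j ^ 'n \<Rightarrow> real ^ 'j ^ 'j \<Rightarrow>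
     real ^ 'j ^ 'n \<Rightarrow> real ^ 'j ^ 'n \<Rightarrow> real ^ 'j ^ 'm \<Rightarrow>
     real ^ (('n + 'n) + 'm) ^ (('n::finite + 'n) + 'm::finite)"
  where "data_matrix \<Phi>11 \<Phi>12 \<Phi>22 Xp X U =
    (let \<Theta> = \<Phi>11 + Xp ** transpose \<Phi>12 + \<Phi>12 ** transpose Xp + Xp ** \<Phi>22 ** transpose Xp;
         N21 = - (X ** transpose \<Phi>12) - X ** \<Phi>22 ** transpose Xp;
         N31 = - (U ** transpose \<Phi>12) - U ** \<Phi>22 ** transpose Xp;
         N22 = X ** \<Phi>22 ** transpose X;
         N32 = U ** \<Phi>22 ** transpose X;
         N33 = U ** \<Phi>22 ** transpose U
     in  \<Theta>   ||| transpose N21 ||| transpose N31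
      ;; N21 ||| N22           ||| transpose N32
      ;; N31 ||| N32           ||| N33)"

end

theory Submission
  imports Defs
begin

text \<open>
  Write \<open>P = Q\<^sub>0\<^sup>-\<^sup>1\<close>, \<open>c = \<eta>\<^sub>0 + \<beta>\<^sub>0\<close>, \<open>A = A\<^sub>o + B\<^sub>o K\<^sub>0\<close>, \<open>C = C\<^sub>1 + D\<^sub>1 K\<^sub>0\<close>. The whole theorem follows from
  one dissipation inequality for the storage function \<open>V(x) = x\<^sup>T P x\<close>:
  \<open>V(A x + w) + |C x|\<^sup>2 \<le> V(x) + |w|\<^sup>2 / c\<close>.

  To obtain it, the first matrix inequality is evaluated at vectors whose first three blocks are
  \<open>(a, A\<^sub>o\<^sup>T a, B\<^sub>o\<^sup>T a)\<close>. At such vectors the quadratic form of the data matrix equals that of the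
  offline noise constraint, because \<open>W\<^sup>T a\<close> is a combination of the data along exactly
  these directions; so it is nonnegative (\<open>noise_form_nonneg\<close>), and since \<open>\<alpha>\<^sub>0 \<ge> 0\<close> the data term
  can be dropped. What is left mentions the unknown pair \<open>(A\<^sub>o, B\<^sub>o)\<close> only through the closed-loop
  matrix, because \<open>K\<^sub>0 Q\<^sub>0 = Y\<^sub>0\<close>. It is a bounded real inequality in dual form, with
  \<open>Q\<^sub>0\<close> instead of \<open>P\<close>, and \<open>dissipation_from_dual_form\<close> turns it into the primal inequality by one
  choice of test vector.

  Stability: for \<open>w = 0\<close> the storage function decreases strictly along every nonzero state. The real
  quadratic form \<open>V\<close> extends to a Hermitian form on complex vectors, so it decreases along
  eigenvectors too, and the eigenvalues lie inside the unit disc. Gain: for \<open>|z| = 1\<close>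
  and \<open>z \<xi> = A \<xi> + w\<close> the storage of \<open>z \<xi>\<close> and of \<open>\<xi>\<close> agree, so the inequality leaves
  \<open>|C \<xi>|\<^sup>2 \<le> |w|\<^sup>2 / c\<close>. Thus the \<open>H\<^sub>\<infinity>\<close> norm is at most \<open>c\<^sup>-\<^sup>1\<^sup>/\<^sup>2\<close>; the slack \<open>\<beta>\<^sub>0 > 0\<close> makes
  this strictly smaller than \<open>\<eta>\<^sub>0\<^sup>-\<^sup>1\<^sup>/\<^sup>2\<close>, also after taking the supremum over the circle.
  Constraints: summing the inequality over time gives \<open>V(x(t)) \<le> V(x(0)) + \<sigma>\<^sub>0 / \<eta>\<^sub>0\<close>, the third
  matrix inequality bounds the right-hand side by \<open>r\<^sub>0\<close>, and the fourth says that every output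
  entry is bounded as required on the ellipsoid \<open>V \<le> r\<^sub>0\<close>.

  Positive semidefiniteness is used throughout in the form "the quadratic form is nonnegative at
  this vector": the choice of test vector replaces each Schur complement.
\<close>

section \<open>Block vectors\<close>

definition stack :: "real ^ 'a \<Rightarrow> real ^ 'b \<Rightarrow> real ^ ('a::finite + 'b::finite)"
  where "stack a b = (\<chi> i. case i of Inl k \<Rightarrow> a $ k | Inr k \<Rightarrow> b $ k)"

lemma sum_UNIV_sum_type:
  fixes f :: "'a::finite + 'b::finite \<Rightarrow> 'c::comm_monoid_add"
  shows "(\<Sum>i\<in>UNIV. f i) = (\<Sum>a\<in>UNIV. f (Inl a)) + (\<Sum>b\<in>UNIV. f (Inr b))"
proof -
  have "(\<Sum>i\<in>UNIV. f i) = (\<Sum>i\<in>UNIV <+> UNIV. f i)"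
    by simp
  also have "\<dots> = (\<Sum>a\<in>UNIV. f (Inl a)) + (\<Sum>b\<in>UNIV. f (Inr b))"
    by (subst sum.Plus) simp_all
  finally show ?thesis .
qed

lemma hcat_mult_stack: "(M ||| M') *v stack a b = M *v a + M' *v b"
  by (simp add: vec_eq_iff matrix_vector_mult_def hcat_def stack_def sum_UNIV_sum_type)

lemma vcat_mult: "(M ;; M') *v v = stack (M *v v) (M' *v v)"
  by (simp add: vec_eq_iff matrix_vector_mult_def vcat_def stack_def split: sum.split)

lemma inner_stack: "stack a b \<bullet> stack c d = a \<bullet> c + b \<bullet> d"
  by (simp add: inner_vec_def stack_def sum_UNIV_sum_type)

lemma stack_add: "stack a b + stack c d = stack (a + c) (b + d)"
  by (simp add: vec_eq_iff stack_def split: sum.split)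

lemma stack_eq_zero_iff: "stack a b = 0 \<longleftrightarrow> a = 0 \<and> b = 0"
  by (auto simp: vec_eq_iff stack_def split: sum.split_asm sum.split)

lemmas block_form = hcat_mult_stack vcat_mult stack_add inner_stack


section \<open>Quadratic forms\<close>

lemma inner_mult_transpose:
  fixes A :: "real ^ 'n ^ 'm"
  shows "x \<bullet> (A *v y) = (transpose A *v x) \<bullet> y"
  by (metis dot_lmul_matrix transpose_matrix_vector)

lemma inner_symmetric_commute:
  fixes M :: "real ^ 'n ^ 'n"
  assumes "transpose M = M"
  shows "x \<bullet> (M *v y) = y \<bullet> (M *v x)"
  by (metis assms inner_commute inner_mult_transpose)

lemma matrix_vector_uminus:
  fixes M :: "'a::comm_ring_1 ^ 'n ^ 'm"
  shows "(- M) *v v = - (M *v v)" "M *v (- v) = - (M *v v)"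
  by (simp_all add: vec_eq_iff matrix_vector_mult_def sum_negf)

lemma congruence_form:
  fixes M :: "real ^ 'm ^ 'm" and T :: "real ^ 'n ^ 'm"
  shows "v \<bullet> ((transpose T ** M ** T) *v v) = (T *v v) \<bullet> (M *v (T *v v))"
  using inner_mult_transpose[of v "transpose T" "M *v (T *v v)"]
  by (simp flip: matrix_vector_mul_assoc)

lemma semidef_ge_form:
  assumes "M \<succeq> M'"
  shows "v \<bullet> (M' *v v) \<le> v \<bullet> (M *v v)"
  using assms
  by (simp add: semidef_ge_def pos_semidef_def matrix_vector_mult_diff_rdistrib inner_diff_right)

lemma def_gt_zero_form:
  assumes "M \<succ> 0" "v \<noteq> 0"
  shows "0 < v \<bullet> (M *v v)"
  using assms by (simp add: def_gt_def pos_def_def)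

lemma positive_form_invertible:
  fixes M :: "real ^ 'n ^ 'n"
  assumes "\<And>v. v \<noteq> 0 \<Longrightarrow> 0 < v \<bullet> (M *v v)"
  shows "invertible M"
proof -
  have "\<forall>v. M *v v = 0 \<longrightarrow> v = 0"
    using assms by fastforce
  then show ?thesis
    by (metis invertible_def matrix_left_invertible_ker matrix_left_right_inverse)
qed

lemma matrix_inv_inverse:
  fixes M :: "'a::field ^ 'n ^ 'n"
  assumes "invertible M"
  shows "M ** matrix_inv M = mat 1" "matrix_inv M ** M = mat 1"
  using someI_ex[OF assms[unfolded invertible_def]] by (simp_all add: matrix_inv_def)

lemma mult_matrix_inv_cancel:
  fixes M :: "'a::field ^ 'n ^ 'n"
  assumes "invertible M"
  shows "M *v (matrix_inv M *v x) = x" "matrix_inv M *v (M *v x) = x"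
  using matrix_inv_inverse[OF assms] by (simp_all add: matrix_vector_mul_assoc)

lemma transpose_matrix_inv_symmetric:
  fixes M :: "real ^ 'n ^ 'n"
  assumes "invertible M" "transpose M = M"
  shows "transpose (matrix_inv M) = matrix_inv M"
  by (metis assms matrix_inv_inverse matrix_mul_assoc matrix_mul_lid matrix_mul_rid matrix_transpose_mul transpose_mat)


section \<open>The systems that are consistent with the data\<close>

text \<open>
  If \<open>Xp = A X + B U + W\<close>, then the vector \<open>g\<close> below is \<open>W\<^sup>T a\<close> as soon as \<open>b = A\<^sup>T a\<close> and \<open>c = B\<^sup>T a\<close>: the
  data matrix is the noise multiplier \<open>\<Phi>\<close> with the noise eliminated in favour of the data.
\<close>

lemma data_matrix_form:
  fixes Xp X :: "real ^ 'j ^ 'n" and U :: "real ^ 'j ^ 'm"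
  assumes "transpose \<Phi>22 = \<Phi>22"
  defines "g a b c \<equiv> transpose Xp *v a - transpose X *v b - transpose U *v c"
  shows "stack (stack a b) c \<bullet> (data_matrix \<Phi>11 \<Phi>12 \<Phi>22 Xp X U *v stack (stack a b) c)
       = a \<bullet> (\<Phi>11 *v a) + 2 * (a \<bullet> (\<Phi>12 *v g a b c)) + g a b c \<bullet> (\<Phi>22 *v g a b c)"
proof -
  have tdiff: "transpose (- M - M') = - transpose M - transpose M'" for M M' :: "real ^ 'k ^ 'l"
    by (simp add: vec_eq_iff transpose_def)
  have sym: "(\<Phi>22 *v x) \<bullet> y = (\<Phi>22 *v y) \<bullet> x" for x y
    using inner_symmetric_commute[OF assms(1)] by (simp add: inner_commute)
  have s: "a \<bullet> (M *v v) = (transpose M *v a) \<bullet> v" for M :: "real ^ 'k ^ 'l" and a v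
    by (rule inner_mult_transpose)
  show ?thesis
    unfolding g_def
    by (simp add: data_matrix_def Let_def block_form matrix_vector_uminus tdiff matrix_transpose_mul assms(1)
        matrix_vector_mult_diff_rdistrib matrix_vector_mult_add_rdistrib
        matrix_vector_mult_diff_distrib
        inner_add_right inner_diff_right inner_diff_left inner_add_left
        flip: matrix_vector_mul_assoc)
      (simp add: s assms(1) sym inner_commute[of "a v* \<Phi>12"])
qed

text \<open>
  The true system is among those that are consistent with the data: this is how the unknown matrices
  enter the argument.
\<close>

lemma noise_form_nonneg:
  fixes Xp X W :: "real ^ 'j ^ 'n" and U :: "real ^ 'j ^ 'm"
  assumes W: "Xp = A ** X + B ** U + W" and sym: "transpose \<Phi>22 = \<Phi>22"
    and noise: "transpose (mat 1 ;; transpose W)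
        ** (\<Phi>11 ||| \<Phi>12 ;; transpose \<Phi>12 ||| \<Phi>22)
        ** (mat 1 ;; transpose W) \<succeq> 0"
  defines "v a \<equiv> stack (stack a (transpose A *v a)) (transpose B *v a)"
  shows "0 \<le> v a \<bullet> (data_matrix \<Phi>11 \<Phi>12 \<Phi>22 Xp X U *v v a)"
proof -
  define g where "g = transpose W *v a"
  have "0 \<le> stack a g \<bullet> ((\<Phi>11 ||| \<Phi>12 ;; transpose \<Phi>12 ||| \<Phi>22) *v stack a g)"
    using semidef_ge_form[OF noise, of a] by (simp add: congruence_form vcat_mult g_def)
  also have "\<dots> = a \<bullet> (\<Phi>11 *v a) + 2 * (a \<bullet> (\<Phi>12 *v g)) + g \<bullet> (\<Phi>22 *v g)"
    using inner_mult_transpose[of a \<Phi>12 g]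
    by (simp only: block_form inner_add_right) (simp add: inner_commute)
  also have "g = transpose Xp *v a - transpose X *v (transpose A *v a) - transpose U *v (transpose B *v a)"
  proof -
    have "transpose (A ** X + B ** U + W) = transpose X ** transpose A + transpose U ** transpose B + transpose W"
      by (simp add: vec_eq_iff transpose_def matrix_matrix_mult_def mult.commute)
    then show ?thesis
      unfolding g_def W
      by (simp add: matrix_vector_mult_add_rdistrib flip: matrix_vector_mul_assoc)
  qed
  finally show ?thesis
    unfolding v_def data_matrix_form[OF sym] .
qed


section \<open>Dissipation\<close>

text \<open>
  The assumption is used at \<open>d = - P x\<close>, \<open>e = C x\<close>. With the next state \<open>x' = A x + w\<close> it then bounds
  \<open>2 a\<^sup>T x' - a\<^sup>T Q a\<close>, up to terms in \<open>a\<^sup>T w\<close> and \<open>|a|\<^sup>2\<close>, by \<open>x\<^sup>T P x - |C x|\<^sup>2\<close>. This concave function of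
  \<open>a\<close> is largest at \<open>a = P x'\<close>, where it equals the storage of \<open>x'\<close>. The term \<open>c * |P x'|\<^sup>2\<close> is kept on
  the left: Young's inequality trades it against \<open>w\<close> for the gain bound, and for \<open>w = 0\<close> it makes the
  decrease of the storage strict.
\<close>

lemma dissipation_from_dual_form:
  fixes A Q :: "real ^ 'n ^ 'n" and C :: "real ^ 'n ^ 'p"
  assumes sym: "transpose Q = Q" and inv: "invertible Q"
    and lmi: "\<And>a d e. 0 \<le> a \<bullet> (Q *v a) - c * (a \<bullet> a) + 2 * (d \<bullet> (Q *v (transpose A *v a)))
                         + d \<bullet> (Q *v d) + 2 * (e \<bullet> (C *v (Q *v d))) + e \<bullet> e"
  defines "P \<equiv> matrix_inv Q"
  shows "(A *v x + w) \<bullet> (P *v (A *v x + w)) + (norm (C *v x))\<^sup>2 + c * (norm (P *v (A *v x + w)))\<^sup>2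
         \<le> x \<bullet> (P *v x) + 2 * ((P *v (A *v x + w)) \<bullet> w)"
proof -
  define x' where "x' = A *v x + w"
  define a where "a = P *v x'"
  define d where "d = - (P *v x)"
  have Qa: "Q *v a = x'"
    using mult_matrix_inv_cancel[OF inv] by (simp add: a_def P_def)
  have Qd: "Q *v d = - x"
    using mult_matrix_inv_cancel[OF inv] by (simp add: d_def P_def matrix_vector_uminus)
  have "d \<bullet> (Q *v (transpose A *v a)) = - (x \<bullet> (transpose A *v a))"
    by (subst inner_symmetric_commute[OF sym]) (simp add: Qd inner_commute)
  also have "x \<bullet> (transpose A *v a) = (x' - w) \<bullet> a"
    by (subst inner_mult_transpose) (simp add: x'_def)
  finally have cross: "d \<bullet> (Q *v (transpose A *v a)) = - ((x' - w) \<bullet> a)" .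
  have dQd: "d \<bullet> (Q *v d) = x \<bullet> (P *v x)"
    unfolding Qd by (simp add: d_def inner_commute)
  have "0 \<le> a \<bullet> x' - c * (a \<bullet> a) - 2 * ((x' - w) \<bullet> a) + x \<bullet> (P *v x)
           + 2 * ((C *v x) \<bullet> (C *v (- x))) + (C *v x) \<bullet> (C *v x)"
    using lmi[of a d "C *v x"] by (simp only: cross dQd) (simp add: Qa Qd)
  then show ?thesis
    by (simp add: matrix_vector_uminus x'_def[symmetric] a_def[symmetric] power2_norm_eq_inner inner_commute inner_diff_right)
qed

lemma young_inner:
  fixes a w :: "'a::real_inner"
  assumes "c > 0"
  shows "2 * (a \<bullet> w) \<le> c * (norm a)\<^sup>2 + (norm w)\<^sup>2 / c"
proof -
  have "0 \<le> (norm (c *\<^sub>R a - w))\<^sup>2"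
    by simp
  also have "\<dots> = c * (c * (norm a)\<^sup>2 + (norm w)\<^sup>2 / c - 2 * (a \<bullet> w))"
    using assms
    by (simp add: power2_norm_eq_inner inner_diff_left inner_diff_right inner_commute algebra_simps)
  finally show ?thesis
    using assms by (simp add: zero_le_mult_iff)
qed


section \<open>Real and imaginary parts of complex vectors\<close>

definition Re_vec :: "complex ^ 'n \<Rightarrow> real ^ 'n"
  where "Re_vec v = (\<chi> i. Re (v $ i))"

definition Im_vec :: "complex ^ 'n \<Rightarrow> real ^ 'n"
  where "Im_vec v = (\<chi> i. Im (v $ i))"

lemma complex_vec_eq_zero_iff: "v = 0 \<longleftrightarrow> Re_vec v = 0 \<and> Im_vec v = 0"
  by (auto simp: vec_eq_iff Re_vec_def Im_vec_def complex_eq_iff)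

lemma Re_Im_vec_add:
  "Re_vec (v + w) = Re_vec v + Re_vec w" "Im_vec (v + w) = Im_vec v + Im_vec w"
  by (simp_all add: vec_eq_iff Re_vec_def Im_vec_def)

lemma Re_Im_vec_mult:
  "Re_vec (complex_mat M *v v) = M *v Re_vec v" "Im_vec (complex_mat M *v v) = M *v Im_vec v"
  by (simp_all add: vec_eq_iff Re_vec_def Im_vec_def matrix_vector_mult_def map_matrix_def)

lemma Re_Im_vec_scale:
  "Re_vec (z *s v) = Re z *\<^sub>R Re_vec v - Im z *\<^sub>R Im_vec v"
  "Im_vec (z *s v) = Re z *\<^sub>R Im_vec v + Im z *\<^sub>R Re_vec v"
  by (simp_all add: vec_eq_iff Re_vec_def Im_vec_def)

lemma norm_complex_vec: "(norm v)\<^sup>2 = (norm (Re_vec v))\<^sup>2 + (norm (Im_vec v))\<^sup>2"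
  by (simp add: power2_norm_eq_inner inner_vec_def Re_vec_def Im_vec_def inner_complex_def
      sum.distrib)

text \<open>
  The form \<open>v\<^sup>* P v\<close> for real symmetric \<open>P\<close>, written with real quadratic forms so that inequalities
  proved for real vectors can be added up over the real and imaginary part.
\<close>

definition hermitian_form :: "real ^ 'n ^ 'n \<Rightarrow> complex ^ 'n \<Rightarrow> real"
  where "hermitian_form P v = Re_vec v \<bullet> (P *v Re_vec v) + Im_vec v \<bullet> (P *v Im_vec v)"

text \<open>
  Rotating the phase of a complex vector mixes its real and imaginary parts; the cross terms cancel
  because \<open>P\<close> is symmetric.
\<close>

lemma hermitian_form_scale:
  assumes "transpose P = P"
  shows "hermitian_form P (z *s v) = (norm z)\<^sup>2 * hermitian_form P v"
proof -
  have "Im_vec v \<bullet> (P *v Re_vec v) = Re_vec v \<bullet> (P *v Im_vec v)"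
    by (rule inner_symmetric_commute[OF assms])
  then show ?thesis
    unfolding cmod_power2
    by (simp add: hermitian_form_def Re_Im_vec_scale matrix_vector_mult_diff_distrib
        matrix_vector_right_distrib matrix_vector_mult_scaleR inner_add_left inner_add_right
        inner_diff_left inner_diff_right algebra_simps power2_eq_square)
qed


section \<open>Stability from a decreasing storage function\<close>

text \<open>
  The Hermitian form of an eigenvector is multiplied by \<open>|z|\<^sup>2\<close> under \<open>A\<close>. It also decreases strictly,
  because the real or the imaginary part of the eigenvector is nonzero.
\<close>

lemma schur_stable_if_storage_decreases:
  fixes A P :: "real ^ 'n ^ 'n"
  assumes sym: "transpose P = P" and nonneg: "\<And>x. 0 \<le> x \<bullet> (P *v x)"
    and decr: "\<And>x. x \<noteq> 0 \<Longrightarrow> (A *v x) \<bullet> (P *v (A *v x)) < x \<bullet> (P *v x)"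
  shows "schur_stable A"
  unfolding schur_stable_def mat_eigenvalue_def
proof safe
  fix z v
  assume v: "v \<noteq> 0" and eig: "complex_mat A *v v = z *s v"
  have le: "(A *v x) \<bullet> (P *v (A *v x)) \<le> x \<bullet> (P *v x)" for x
    using decr[of x] by (cases "x = 0") auto
  have "(norm z)\<^sup>2 * hermitian_form P v = hermitian_form P (complex_mat A *v v)"
    by (simp add: eig hermitian_form_scale[OF sym])
  also have "\<dots> < hermitian_form P v"
    using v decr[of "Re_vec v"] decr[of "Im_vec v"] le[of "Re_vec v"] le[of "Im_vec v"]
    unfolding hermitian_form_def Re_Im_vec_mult complex_vec_eq_zero_iff by linarith
  finally have lt: "(norm z)\<^sup>2 * hermitian_form P v < hermitian_form P v" .
  moreover have "0 \<le> hermitian_form P v"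
    by (simp add: hermitian_form_def nonneg)
  ultimately have "(norm z)\<^sup>2 < 1"
    by (metis linorder_not_less mult_1 mult_right_mono)
  then show "norm z < 1"
    by (simp add: abs_square_less_1)
qed


section \<open>The largest singular value\<close>

lemma inner_complex_vec: "v \<bullet> w = Re (\<Sum>i\<in>UNIV. v $ i * cnj (w $ i))"
  by (simp add: inner_vec_def inner_complex_def)

text \<open>
  The inner product on complex vectors is the real one, that is, the real part of the Hermitian
  product. It suffices here: the conjugate transpose is also the adjoint for it.
\<close>

lemma inner_conj_transpose:
  fixes M :: "complex ^ 'n ^ 'm"
  shows "(M *v v) \<bullet> w = v \<bullet> (conj_transpose M *v w)"
proof -
  have "(\<Sum>i\<in>UNIV. (M *v v) $ i * cnj (w $ i)) = (\<Sum>i\<in>UNIV. \<Sum>j\<in>UNIV. M $ i $ j * v $ j * cnj (w $ i))"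
    by (simp add: matrix_vector_mult_def sum_distrib_right)
  also have "\<dots> = (\<Sum>j\<in>UNIV. \<Sum>i\<in>UNIV. M $ i $ j * v $ j * cnj (w $ i))"
    by (rule sum.swap)
  also have "\<dots> = (\<Sum>j\<in>UNIV. v $ j * cnj ((conj_transpose M *v w) $ j))"
    by (simp add: matrix_vector_mult_def sum_distrib_left conj_transpose_def transpose_def
        map_matrix_def mult_ac)
  finally show ?thesis
    by (simp only: inner_complex_vec)
qed

lemma gram_form:
  fixes M :: "complex ^ 'n ^ 'm"
  shows "v \<bullet> ((conj_transpose M ** M) *v w) = (M *v v) \<bullet> (M *v w)"
  by (simp add: inner_conj_transpose flip: matrix_vector_mul_assoc)

lemma of_real_vector_scale:
  fixes v :: "complex ^ 'n"
  shows "complex_of_real r *s v = r *\<^sub>R v"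
  by (simp add: vec_eq_iff complex_eq_iff)

definition singular_values :: "complex ^ 'n ^ 'm \<Rightarrow> real set"
  where "singular_values M =
    {s. 0 \<le> s \<and> mat_eigenvalue (conj_transpose M ** M) (complex_of_real (s\<^sup>2))}"

lemma singular_value_vector:
  assumes "s \<in> singular_values M"
  obtains v where "v \<noteq> 0" "(conj_transpose M ** M) *v v = s\<^sup>2 *\<^sub>R v"
  using assms unfolding singular_values_def mat_eigenvalue_def of_real_vector_scale by auto

text \<open>
  Eigenvectors of the Gram matrix for different eigenvalues are orthogonal, and a finite-dimensional
  space has no infinite set of pairwise orthogonal vectors.
\<close>

lemma finite_singular_values:
  fixes M :: "complex ^ 'n ^ 'm"
  shows "finite (singular_values M)"
proof -
  define S where "S = conj_transpose M ** M"
  have "\<forall>s\<in>singular_values M. \<exists>v. v \<noteq> 0 \<and> S *v v = s\<^sup>2 *\<^sub>R v"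
    unfolding S_def by (meson singular_value_vector)
  then obtain f where nz: "\<And>s. s \<in> singular_values M \<Longrightarrow> f s \<noteq> 0"
      and eig: "\<And>s. s \<in> singular_values M \<Longrightarrow> S *v f s = s\<^sup>2 *\<^sub>R f s"
    by metis
  have orth: "f s \<bullet> f t = 0" if "s \<in> singular_values M" "t \<in> singular_values M" "s \<noteq> t" for s t
  proof -
    have "f t \<bullet> (S *v f s) = f s \<bullet> (S *v f t)"
      unfolding S_def gram_form by (rule inner_commute)
    then have "(s\<^sup>2 - t\<^sup>2) * (f s \<bullet> f t) = 0"
      using that by (simp add: eig inner_commute algebra_simps)
    moreover have "s\<^sup>2 \<noteq> t\<^sup>2"
      using that by (simp add: singular_values_def)
    ultimately show ?thesis
      by simp
  qed
  have "inj_on f (singular_values M)"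
    using orth nz by (metis inj_onI inner_eq_zero_iff)
  moreover have "pairwise orthogonal (f ` singular_values M)"
    using orth by (auto simp: pairwise_def orthogonal_def)
  ultimately show ?thesis
    using pairwise_orthogonal_imp_finite finite_imageD by blast
qed

text \<open>
  A maximizer \<open>v0\<close> of \<open>|M v|\<close> on the unit sphere is a right singular vector: with \<open>s = |M v0|\<close>, the form
  \<open>F v = s\<^sup>2 |v|\<^sup>2 - |M v|\<^sup>2\<close> is nonnegative and vanishes at \<open>v0\<close>, so its gradient vanishes there,
  and this gradient is twice the residual of the eigenvalue equation.
\<close>

lemma singular_values_nonempty:
  fixes M :: "complex ^ 'n ^ 'm"
  shows "singular_values M \<noteq> {}"
proof -
  have "continuous_on (sphere 0 1) (\<lambda>v. norm (M *v v))"
    by (intro continuous_intros linear_continuous_on matrix_vector_mul_bounded_linear)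
  moreover have "axis undefined 1 \<in> (sphere 0 1 :: (complex ^ 'n) set)"
    by (simp add: norm_axis_1)
  ultimately obtain v0 where v0: "norm v0 = 1" and max: "\<And>v. norm v = 1 \<Longrightarrow> norm (M *v v) \<le> norm (M *v v0)"
    using continuous_attains_sup[of "sphere 0 1" "\<lambda>v. norm (M *v v)"] by auto
  define s where "s = norm (M *v v0)"
  have bound: "norm (M *v v) \<le> s * norm v" for v
  proof (cases "v = 0")
    case False
    have "norm (M *v (inverse (norm v) *\<^sub>R v)) \<le> s"
      using max[of "inverse (norm v) *\<^sub>R v"] False by (simp add: s_def)
    then show ?thesis
      using False linear_scale[OF bounded_linear.linear[OF matrix_vector_mul_bounded_linear[of M]]]
      by (simp add: field_simps)
  qed simp
  define S where "S = conj_transpose M ** M"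
  define r where "r = s\<^sup>2 *\<^sub>R v0 - S *v v0"
  define F where "F v = s\<^sup>2 * (v \<bullet> v) - v \<bullet> (S *v v)" for v
  have F_nonneg: "0 \<le> F v" for v
    using power_mono[OF bound, of v 2]
    by (simp add: F_def S_def gram_form power2_norm_eq_inner power_mult_distrib)
  have F_v0: "F v0 = 0"
    using v0 by (simp add: F_def S_def gram_form s_def flip: power2_norm_eq_inner)
  have F_line: "F (v0 + t *\<^sub>R r) = 2 * t * (r \<bullet> r) + t\<^sup>2 * F r" for t
  proof -
    have sym: "v0 \<bullet> (S *v r) = r \<bullet> (S *v v0)"
      unfolding S_def gram_form by (rule inner_commute)
    have lin: "S *v (v0 + t *\<^sub>R r) = S *v v0 + t *\<^sub>R (S *v r)"
      using linear_add linear_scale bounded_linear.linear[OF matrix_vector_mul_bounded_linear[of S]]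
      by metis
    have "F (v0 + t *\<^sub>R r) = F v0 + 2 * t * (s\<^sup>2 * (r \<bullet> v0) - r \<bullet> (S *v v0)) + t\<^sup>2 * F r"
      unfolding F_def lin
      by (simp add: inner_add_left inner_add_right sym inner_commute algebra_simps power2_eq_square)
    also have "s\<^sup>2 * (r \<bullet> v0) - r \<bullet> (S *v v0) = r \<bullet> r"
      by (simp add: r_def inner_diff_right)
    finally show ?thesis
      using F_v0 by simp
  qed
  have "r \<bullet> r = 0"
  proof (rule ccontr)
    assume "r \<bullet> r \<noteq> 0"
    then have pos: "r \<bullet> r > 0"
      by simp
    \<comment> \<open>a small step from \<open>v0\<close> against the residual makes \<open>F\<close> negative; the summand 1 covers \<open>F r = 0\<close>\<close>
    define k where "k = F r + 1"
    have k: "k > 0" "F r = k - 1"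
      using F_nonneg[of r] by (auto simp: k_def)
    have "0 \<le> 2 * (- (r \<bullet> r) / k) * (r \<bullet> r) + (- (r \<bullet> r) / k)\<^sup>2 * (k - 1)"
      using F_nonneg[of "v0 + (- (r \<bullet> r) / k) *\<^sub>R r"] unfolding F_line k(2) .
    also have "\<dots> = - ((r \<bullet> r)\<^sup>2 * (k + 1) / k\<^sup>2)"
      using k by (simp add: field_simps power2_eq_square)
    also have "\<dots> < 0"
      using k pos by simp
    finally show False
      by simp
  qed
  then have "S *v v0 = complex_of_real (s\<^sup>2) *s v0"
    by (simp add: r_def of_real_vector_scale del: of_real_power)
  moreover have "v0 \<noteq> 0" "0 \<le> s"
    using v0 by (auto simp: s_def)
  ultimately have "s \<in> singular_values M"
    unfolding singular_values_def mat_eigenvalue_def S_def by blast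
  then show ?thesis
    by blast
qed

text \<open>
  The maximum in the definition is attained because the set is finite and nonempty, so bounding each
  singular value by the gain along its singular vector is enough.
\<close>

lemma max_singular_value_le:
  fixes M :: "complex ^ 'n ^ 'm"
  assumes gain: "\<And>v. (norm (M *v v))\<^sup>2 \<le> b\<^sup>2 * (norm v)\<^sup>2" and "0 \<le> b"
  shows "max_singular_value M \<le> b"
proof -
  have "s \<le> b" if "s \<in> singular_values M" for s
  proof -
    obtain v where v: "v \<noteq> 0" "(conj_transpose M ** M) *v v = s\<^sup>2 *\<^sub>R v"
      using \<open>s \<in> singular_values M\<close> by (rule singular_value_vector)
    have "s\<^sup>2 * (norm v)\<^sup>2 = (norm (M *v v))\<^sup>2"
      using gram_form[of v M v] v(2) by (simp add: power2_norm_eq_inner)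
    with gain[of v] have "s\<^sup>2 * (norm v)\<^sup>2 \<le> b\<^sup>2 * (norm v)\<^sup>2"
      by simp
    then have "s\<^sup>2 \<le> b\<^sup>2"
      using v(1) by simp
    then show ?thesis
      using \<open>0 \<le> b\<close> by (rule power2_le_imp_le)
  qed
  then show ?thesis
    using finite_singular_values[of M] singular_values_nonempty[of M]
    unfolding max_singular_value_def singular_values_def[symmetric] by simp
qed

section \<open>Gain of a dissipative system\<close>

text \<open>
  On the unit circle the storage of a harmonic state \<open>\<xi>\<close> does not change in one step, since
  \<open>z \<xi>\<close> and \<open>\<xi>\<close> differ by a phase. The dissipation inequality then compares output and input directly.
  Stability ensures that the resolvent exists there.
\<close>

lemma hinf_norm_le_if_dissipative:
  fixes A P :: "real ^ 'n ^ 'n" and C :: "real ^ 'n ^ 'p"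
  assumes sym: "transpose P = P" and "c > 0" and stable: "schur_stable A"
    and diss: "\<And>x w. (A *v x + w) \<bullet> (P *v (A *v x + w)) + (norm (C *v x))\<^sup>2
                        \<le> x \<bullet> (P *v x) + (norm w)\<^sup>2 / c"
  shows "hinf_norm (transfer_matrix A C) \<le> ereal (c powr (- 1 / 2))"
  unfolding hinf_norm_def
proof (rule SUP_least)
  fix z :: complex
  assume "z \<in> {z. norm z = 1}"
  then have z: "norm z = 1"
    by simp
  define R where "R = mat z - complex_mat A"
  have R_mult: "R *v v = z *s v - complex_mat A *v v" for v
  proof -
    have "mat z *v v = z *s v"
      by (simp add: vec_eq_iff matrix_vector_mult_def mat_def if_distrib if_distribR cong: if_cong)
    then show ?thesis
      by (simp add: R_def matrix_vector_mult_diff_rdistrib)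
  qed
  have "v = 0" if "R *v v = 0" for v
  proof (rule ccontr)
    assume "v \<noteq> 0"
    moreover have "complex_mat A *v v = z *s v"
      using that by (simp add: R_mult)
    ultimately have "norm z < 1"
      using stable unfolding schur_stable_def mat_eigenvalue_def by blast
    with z show False
      by simp
  qed
  then have inv: "invertible R"
    by (metis invertible_def matrix_left_invertible_ker matrix_left_right_inverse)
  have gain: "(norm (transfer_matrix A C z *v u))\<^sup>2 \<le> (c powr (- 1 / 2))\<^sup>2 * (norm u)\<^sup>2" for u
  proof -
    define \<xi> where "\<xi> = matrix_inv R *v u"
    have "z *s \<xi> - complex_mat A *v \<xi> = u"
      using mult_matrix_inv_cancel(1)[OF inv, of u] by (simp add: \<xi>_def R_mult)
    then have next_state: "z *s \<xi> = complex_mat A *v \<xi> + u"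
      by (simp add: algebra_simps)
    have out: "transfer_matrix A C z *v u = complex_mat C *v \<xi>"
      by (simp add: transfer_matrix_def \<xi>_def R_def flip: matrix_vector_mul_assoc)
    have "hermitian_form P (z *s \<xi>) + (norm (complex_mat C *v \<xi>))\<^sup>2 \<le> hermitian_form P \<xi> + (norm u)\<^sup>2 / c"
      using diss[of "Re_vec \<xi>" "Re_vec u"] diss[of "Im_vec \<xi>" "Im_vec u"]
      unfolding next_state hermitian_form_def norm_complex_vec Re_Im_vec_add Re_Im_vec_mult
      by (simp add: add_divide_distrib)
    then have "(norm (complex_mat C *v \<xi>))\<^sup>2 \<le> (norm u)\<^sup>2 / c"
      by (simp add: hermitian_form_scale[OF sym] z)
    also have "\<dots> = (c powr (- 1 / 2))\<^sup>2 * (norm u)\<^sup>2"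
      using \<open>c > 0\<close> by (simp add: power2_eq_square powr_minus_divide flip: powr_add)
    finally show ?thesis
      by (simp add: out)
  qed
  show "ereal (max_singular_value (transfer_matrix A C z)) \<le> ereal (c powr (- 1 / 2))"
    using max_singular_value_le[OF gain] by simp
qed

section \<open>The closed loop\<close>

lemma storage_bounded:
  fixes w :: "nat \<Rightarrow> 'a::real_normed_vector" and s :: "nat \<Rightarrow> real"
  assumes step: "\<And>t. s (Suc t) \<le> s t + (norm (w t))\<^sup>2 / c" and "c > 0"
    and "summable (\<lambda>t. (norm (w t))\<^sup>2)"
  shows "s t \<le> s 0 + (\<Sum>t. (norm (w t))\<^sup>2) / c"
proof -
  have "s t \<le> s 0 + (\<Sum>k<t. (norm (w k))\<^sup>2) / c"
  proof (induction t)
    case (Suc t)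
    with step[of t] show ?case
      by (simp add: add_divide_distrib)
  qed simp
  also have "\<dots> \<le> s 0 + (\<Sum>t. (norm (w t))\<^sup>2) / c"
    using assms by (intro add_left_mono divide_right_mono sum_le_suminf) auto
  finally show ?thesis .
qed

text \<open>
  The test vector \<open>(1, - Q\<^sup>-\<^sup>1 x, - 1 / q)\<close> minimizes the form among the vectors with first entry 1; the
  minimum is the Schur complement \<open>r - x\<^sup>T Q\<^sup>-\<^sup>1 x - 1 / q\<close>.
\<close>

lemma initial_state_bound:
  fixes Q :: "real ^ 'n ^ 'n" and x :: "real ^ 'n"
  assumes inv: "invertible Q" and "q > 0"
    and lmi: "scalar_block r ||| rowvector x ||| scalar_block 1
           ;; columnvector x ||| Q ||| 0
           ;; scalar_block 1 ||| 0 ||| scalar_block q \<succeq> 0"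
  shows "x \<bullet> (matrix_inv Q *v x) + 1 / q \<le> r"
proof -
  define e :: "real ^ 1" where "e = 1"
  define p where "p = matrix_inv Q *v x"
  have Qp: "Q *v p = x"
    using mult_matrix_inv_cancel[OF inv] by (simp add: p_def)
  have row: "rowvector x *v p = (x \<bullet> p) *\<^sub>R e"
    by (simp add: vec_eq_iff matrix_vector_mult_def rowvector_def inner_vec_def e_def)
  have col: "columnvector x *v e = x"
    by (simp add: vec_eq_iff matrix_vector_mult_def columnvector_def e_def)
  have scal: "scalar_block c *v (k *\<^sub>R e) = (c * k) *\<^sub>R e" for c k
    by (simp add: vec_eq_iff matrix_vector_mult_def mat_def e_def)
  have scal1: "scalar_block c *v e = c *\<^sub>R e" for c
    using scal[of c 1] by simp
  have ee: "e \<bullet> e = 1"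
    by (simp add: e_def inner_vec_def)
  show ?thesis
    using semidef_ge_form[OF lmi, of "stack (stack e (- p)) ((- 1 / q) *\<^sub>R e)"] \<open>q > 0\<close>
    by (simp only: block_form row col scal scal1 Qp matrix_vector_uminus)
      (simp add: inner_diff_right inner_add_right inner_add_left ee Qp inner_commute p_def)
qed

text \<open>
  The matrix inequality says that the \<open>v\<close>-th entry \<open>y\<close> of the output satisfies
  \<open>y\<^sup>2 \<le> (b\<^sup>2 / r) * (x\<^sup>T Q\<^sup>-\<^sup>1 x)\<close>.
\<close>

lemma output_bound:
  fixes Q :: "real ^ 'n ^ 'n" and x :: "real ^ 'n" and M :: "real ^ 'n ^ 'p"
  assumes inv: "invertible Q" and "r > 0" and "0 \<le> b"
    and lmi: "scalar_block (b\<^sup>2 * inverse r) ||| rowvector (axis v 1) ** M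
           ;; transpose M ** columnvector (axis v 1) ||| Q \<succeq> 0"
    and bound: "x \<bullet> (matrix_inv Q *v x) \<le> r"
  shows "(M *v (matrix_inv Q *v x)) $ v \<le> b"
proof (rule ccontr)
  define e :: "real ^ 1" where "e = 1"
  define p where "p = matrix_inv Q *v x"
  define y where "y = (M *v p) $ v"
  assume "\<not> ?thesis"
  then have y: "b < y"
    by (simp add: y_def p_def)
  have Qp: "Q *v p = x"
    using mult_matrix_inv_cancel[OF inv] by (simp add: p_def)
  have row: "(rowvector (axis v 1) ** M) *v p = y *\<^sub>R e"
  proof -
    have "rowvector (axis v 1) *v q = (q $ v) *\<^sub>R e" for q :: "real ^ 'p"
      by (simp add: vec_eq_iff rowvector_def e_def matrix_vector_mult_def axis_def if_distrib
          if_distribR cong: if_cong)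
    then show ?thesis
      by (simp add: y_def flip: matrix_vector_mul_assoc)
  qed
  have col: "p \<bullet> ((transpose M ** columnvector (axis v 1)) *v e) = y"
  proof -
    have "columnvector (axis v 1) *v e = (axis v 1 :: real ^ 'p)"
      by (simp add: vec_eq_iff matrix_vector_mult_def columnvector_def e_def)
    then have "p \<bullet> ((transpose M ** columnvector (axis v 1)) *v e) = p \<bullet> (transpose M *v axis v 1)"
      by (simp flip: matrix_vector_mul_assoc)
    also have "\<dots> = (M *v p) \<bullet> axis v 1"
      by (subst inner_mult_transpose) simp
    finally show ?thesis
      by (simp add: y_def inner_axis)
  qed
  have ee: "e \<bullet> e = 1"
    by (simp add: e_def inner_vec_def)
  have scal: "scalar_block c *v e = c *\<^sub>R e" for c
    by (simp add: vec_eq_iff matrix_vector_mult_def mat_def e_def)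
  \<comment> \<open>dividing by \<open>y\<close> rather than by \<open>b\<close> also covers the bound \<open>b = 0\<close>\<close>
  define k where "k = - r / y"
  have "0 \<le> k\<^sup>2 * (b\<^sup>2 * inverse r) + 2 * k * y + x \<bullet> p"
    using semidef_ge_form[OF lmi, of "stack (k *\<^sub>R e) p"]
    by (simp add: block_form row col scal Qp matrix_vector_mult_scaleR inner_add_right ee
        power2_eq_square inner_commute algebra_simps)
  also have "\<dots> \<le> k\<^sup>2 * (b\<^sup>2 * inverse r) + 2 * k * y + r"
    using bound by (simp add: p_def)
  also have "\<dots> = r * (b\<^sup>2 / y\<^sup>2 - 1)"
    using \<open>r > 0\<close> y \<open>0 \<le> b\<close> by (simp add: k_def field_simps power2_eq_square)
  also have "\<dots> < 0"
    using \<open>r > 0\<close> y \<open>0 \<le> b\<close> by (simp add: mult_pos_neg power_strict_mono)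
  finally show False
    by simp
qed

theorem theorem1:
  fixes Ao :: "real ^ 'n ^ 'n" and Bo :: "real ^ 'm ^ 'n"
    and C1 :: "real ^ 'n ^ 'p1" and D1 :: "real ^ 'm ^ 'p1"
    and C2 :: "real ^ 'n ^ 'p2" and D2 :: "real ^ 'm ^ 'p2"
    and x w :: "nat \<Rightarrow> real ^ 'n" and u :: "nat \<Rightarrow> real ^ 'm"
    and y1 :: "nat \<Rightarrow> real ^ 'p1" and y2 :: "nat \<Rightarrow> real ^ 'p2"
    and y2max :: "real ^ 'p2"
    and xp_data x_data w_data :: "'j::finite \<Rightarrow> real ^ 'n" and u_data :: "'j \<Rightarrow> real ^ 'm"
    and Xp X W :: "real ^ 'j ^ 'n" and U :: "real ^ 'j ^ 'm"
    and \<Phi>11 :: "real ^ 'n ^ 'n" and \<Phi>12 :: "real ^ 'j ^ 'n" and \<Phi>22 :: "real ^ 'j ^ 'j"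
    and N :: "real ^ (('n + 'n) + 'm) ^ (('n + 'n) + 'm)"
    and \<sigma>0 r0 \<eta>0 \<alpha>0 \<beta>0 :: real
    and Q0 :: "real ^ 'n ^ 'n" and Y0 K0 :: "real ^ 'n ^ 'm"
  assumes stabilizable: "stabilizable Ao Bo"
    and detectable: "detectable C1 Ao"
    and y2max_nonneg: "\<forall>v. 0 \<le> y2max $ v"
    and \<sigma>0_pos: "\<sigma>0 > 0" and r0_pos: "r0 > 0"
    \<comment> \<open>offline data\<close>
    and data: "\<forall>j. xp_data j = Ao *v x_data j + Bo *v u_data j + w_data j"
    and Xp_eq: "Xp = of_columns xp_data" and X_eq: "X = of_columns x_data"
    and U_eq: "U = of_columns u_data" and W_eq: "W = of_columns w_data"
    and \<Phi>11_sym: "transpose \<Phi>11 = \<Phi>11"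
    and \<Phi>22_sym: "transpose \<Phi>22 = \<Phi>22" and \<Phi>22_neg: "\<Phi>22 \<prec> 0"
    and N_eq: "N = data_matrix \<Phi>11 \<Phi>12 \<Phi>22 Xp X U"
    and offline_noise:
      "transpose (mat 1 ;; transpose W)
        ** (\<Phi>11 ||| \<Phi>12 ;; transpose \<Phi>12 ||| \<Phi>22)
        ** (mat 1 ;; transpose W) \<succeq> 0"
    and slater:
      "\<exists>(Ab :: real ^ 'n ^ 'n) (Bb :: real ^ 'm ^ 'n).
        transpose (mat 1 ;; transpose Ab ;; transpose Bb)
          ** N ** (mat 1 ;; transpose Ab ;; transpose Bb) \<succ> 0"
    \<comment> \<open>online disturbance\<close>
    and w_summable: "summable (\<lambda>t. (norm (w t))\<^sup>2)"
    and w_bound: "(\<Sum>t. (norm (w t))\<^sup>2) \<le> \<sigma>0"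
    \<comment> \<open>feasibility\<close>
    and \<eta>0_pos: "\<eta>0 > 0" and Q0_sym: "transpose Q0 = Q0"
    and \<alpha>0_nonneg: "\<alpha>0 \<ge> 0" and \<beta>0_pos: "\<beta>0 > 0"
    and lmi1:
      "   Q0 - (\<eta>0 + \<beta>0) *\<^sub>R mat 1 ||| 0  ||| 0            ||| 0                  ||| 0
       ;; 0                         ||| 0  ||| 0            ||| Q0                 ||| 0
       ;; 0                         ||| 0  ||| 0            ||| Y0                 ||| 0
       ;; 0                         ||| Q0 ||| transpose Y0 ||| Q0                 ||| transpose (C1 ** Q0 + D1 ** Y0)
       ;; 0                         ||| 0  ||| 0            ||| C1 ** Q0 + D1 ** Y0 ||| mat 1
       \<succeq> \<alpha>0 *\<^sub>R (N ||| 0 ||| 0 ;;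
                0 ||| 0 ||| 0 ;;
                0 ||| 0 ||| 0)"
    and lmi2:
      "   Q0                  ||| transpose (C1 ** Q0 + D1 ** Y0)
       ;; C1 ** Q0 + D1 ** Y0 ||| mat 1
       \<succ> 0"
    and lmi3:
      "   scalar_block r0    ||| rowvector (x 0) ||| scalar_block 1
       ;; columnvector (x 0) ||| Q0              ||| 0
       ;; scalar_block 1     ||| 0               ||| scalar_block (inverse \<sigma>0 * \<eta>0)
       \<succeq> 0"
    and lmi4:
      "\<forall>v. scalar_block ((y2max $ v)\<^sup>2 * inverse r0)
              ||| rowvector (axis v 1) ** (C2 ** Q0 + D2 ** Y0)
         ;; transpose (C2 ** Q0 + D2 ** Y0) ** columnvector (axis v 1) ||| Q0
         \<succeq> 0"
    \<comment> \<open>closed loop\<close>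
    and K0_eq: "K0 = Y0 ** matrix_inv Q0"
    and state: "\<forall>t. x (t + 1) = Ao *v x t + Bo *v u t + w t"
    and output1: "\<forall>t. y1 t = C1 *v x t + D1 *v u t"
    and output2: "\<forall>t. y2 t = C2 *v x t + D2 *v u t"
    and control: "\<forall>t. u t = K0 *v x t"
  shows "(schur_stable (Ao + Bo ** K0) \<and>
          hinf_norm (transfer_matrix (Ao + Bo ** K0) (C1 + D1 ** K0)) < ereal (\<eta>0 powr (- 1 / 2))) \<and>
         (\<forall>v t. y2 t $ v \<le> y2max $ v)"
proof -
  define A where "A = Ao + Bo ** K0"
  define C where "C = C1 + D1 ** K0"
  define P where "P = matrix_inv Q0"
  define c where "c = \<eta>0 + \<beta>0"
  have c: "c > 0" "\<eta>0 < c"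
    using \<eta>0_pos \<beta>0_pos by (auto simp: c_def)
  have schur: "(norm ((C1 ** Q0 + D1 ** Y0) *v d))\<^sup>2 < d \<bullet> (Q0 *v d)" if "d \<noteq> 0" for d
  proof -
    let ?F = "C1 ** Q0 + D1 ** Y0"
    have "0 < stack d (- (?F *v d)) \<bullet> ((Q0 ||| transpose ?F ;; ?F ||| mat 1) *v stack d (- (?F *v d)))"
      using that by (intro def_gt_zero_form[OF lmi2]) (simp add: stack_eq_zero_iff)
    also have "\<dots> = d \<bullet> (Q0 *v d) - d \<bullet> (transpose ?F *v (?F *v d))"
      by (simp only: block_form matrix_vector_uminus inner_add_right) simp
    also have "d \<bullet> (transpose ?F *v (?F *v d)) = (norm (?F *v d))\<^sup>2"
      unfolding power2_norm_eq_inner by (subst inner_mult_transpose) simp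
    finally show ?thesis
      by simp
  qed
  \<comment> \<open>the second matrix inequality serves to make \<open>Q0\<close> positive definite\<close>
  have Q_pos: "0 < d \<bullet> (Q0 *v d)" if "d \<noteq> 0" for d
    using schur[OF that] by (meson le_less_trans zero_le_power2)
  have inv: "invertible Q0"
    by (rule positive_form_invertible[OF Q_pos])
  have P_sym: "transpose P = P"
    unfolding P_def by (rule transpose_matrix_inv_symmetric[OF inv Q0_sym])
  have QP: "Q0 *v (P *v v) = v" for v
    unfolding P_def by (rule mult_matrix_inv_cancel[OF inv])
  have P_pos: "0 < v \<bullet> (P *v v)" if "v \<noteq> 0" for v
    using Q_pos[of "P *v v"] that QP[of v] by (metis inner_commute matrix_vector_mult_0_right)
  have K_mult: "K0 *v v = Y0 *v (P *v v)" for v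
    by (simp add: K0_eq P_def matrix_vector_mul_assoc)
  have KQ: "K0 *v (Q0 *v v) = Y0 *v v" for v
    unfolding K_mult P_def mult_matrix_inv_cancel(2)[OF inv] ..

  have Xp: "Xp = Ao ** X + Bo ** U + W"
    unfolding Xp_eq X_eq U_eq W_eq
    by (simp add: vec_eq_iff of_columns_def data matrix_matrix_mult_def matrix_vector_mult_def)
  \<comment> \<open>the first matrix inequality in the directions given by the true system\<close>
  have lmi: "0 \<le> a \<bullet> (Q0 *v a) - c * (a \<bullet> a) + 2 * (d \<bullet> (Q0 *v (transpose A *v a)))
               + d \<bullet> (Q0 *v d) + 2 * (e \<bullet> (C *v (Q0 *v d))) + e \<bullet> e" for a d e
  proof -
    let ?F = "C1 ** Q0 + D1 ** Y0"
    let ?b = "transpose Ao *v a" and ?u = "transpose Bo *v a"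
    let ?v = "stack (stack (stack (stack a ?b) ?u) d) e"
    have F: "?F *v d = C *v (Q0 *v d)"
      by (simp add: C_def matrix_vector_mult_add_rdistrib KQ flip: matrix_vector_mul_assoc)
    have "transpose A *v a = ?b + transpose K0 *v ?u"
    proof -
      have "transpose A = transpose Ao + transpose K0 ** transpose Bo"
        by (simp add: A_def vec_eq_iff transpose_def matrix_matrix_mult_def mult.commute)
      then show ?thesis
        by (simp add: matrix_vector_mult_add_rdistrib flip: matrix_vector_mul_assoc)
    qed
    moreover have "d \<bullet> (Q0 *v (transpose K0 *v ?u)) = ?u \<bullet> (Y0 *v d)"
    proof -
      have "d \<bullet> (Q0 *v (transpose K0 *v ?u)) = (transpose K0 *v ?u) \<bullet> (Q0 *v d)"
        by (rule inner_symmetric_commute[OF Q0_sym])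
      also have "\<dots> = ?u \<bullet> (K0 *v (Q0 *v d))"
        by (rule inner_mult_transpose[symmetric])
      finally show ?thesis
        by (simp only: KQ)
    qed
    ultimately have cross: "d \<bullet> (Q0 *v (transpose A *v a)) = d \<bullet> (Q0 *v ?b) + ?u \<bullet> (Y0 *v d)"
      by (simp only: matrix_vector_right_distrib inner_add_right)
    have "0 \<le> \<alpha>0 * (stack (stack a ?b) ?u \<bullet> (N *v stack (stack a ?b) ?u))"
      using \<alpha>0_nonneg noise_form_nonneg[OF Xp \<Phi>22_sym offline_noise] by (simp add: N_eq)
    also have "\<dots> = ?v \<bullet> ((\<alpha>0 *\<^sub>R (N ||| 0 ||| 0 ;; 0 ||| 0 ||| 0 ;; 0 ||| 0 ||| 0)) *v ?v)"
      by (simp add: block_form flip: scaleR_matrix_vector_assoc)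
    also have "\<dots> \<le> a \<bullet> (Q0 *v a) - c * (a \<bullet> a) + ?b \<bullet> (Q0 *v d) + ?u \<bullet> (Y0 *v d)
        + (d \<bullet> (Q0 *v ?b) + d \<bullet> (transpose Y0 *v ?u) + d \<bullet> (Q0 *v d) + d \<bullet> (transpose ?F *v e))
        + (e \<bullet> (?F *v d) + e \<bullet> e)"
      using semidef_ge_form[OF lmi1, of ?v]
      by (simp add: block_form matrix_vector_mult_diff_rdistrib inner_add_right inner_diff_right c_def
          del: transpose_matrix_vector flip: scaleR_matrix_vector_assoc)
    also have "?b \<bullet> (Q0 *v d) = d \<bullet> (Q0 *v ?b)"
      by (rule inner_symmetric_commute[OF Q0_sym])
    also have "d \<bullet> (transpose Y0 *v ?u) = ?u \<bullet> (Y0 *v d)"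
      unfolding inner_mult_transpose[of d] transpose_transpose by (rule inner_commute)
    also have "d \<bullet> (transpose ?F *v e) = e \<bullet> (?F *v d)"
      unfolding inner_mult_transpose[of d] transpose_transpose by (rule inner_commute)
    finally show ?thesis
      unfolding cross F by simp
  qed
  note dissipation = dissipation_from_dual_form[OF Q0_sym inv lmi, folded P_def]
  have diss: "(A *v z + v) \<bullet> (P *v (A *v z + v)) + (norm (C *v z))\<^sup>2
              \<le> z \<bullet> (P *v z) + (norm v)\<^sup>2 / c" for z v
    using dissipation[of z v] young_inner[OF c(1), of "P *v (A *v z + v)" v] by linarith
  have stable: "schur_stable A"
  proof (rule schur_stable_if_storage_decreases[OF P_sym])
    show "0 \<le> z \<bullet> (P *v z)" for z
      using P_pos[of z] by (cases "z = 0") auto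
    fix z :: "real ^ 'n"
    assume z: "z \<noteq> 0"
    show "(A *v z) \<bullet> (P *v (A *v z)) < z \<bullet> (P *v z)"
    \<comment> \<open>the term \<open>c * |P (A z)|\<^sup>2\<close> makes the decrease strict unless the next state is zero\<close>
    proof (cases "A *v z = 0")
      case True
      then show ?thesis
        using P_pos[OF z] by simp
    next
      case False
      then have "P *v (A *v z) \<noteq> 0"
        using QP[of "A *v z"] by (metis matrix_vector_mult_0_right)
      then have "0 < c * (norm (P *v (A *v z)))\<^sup>2"
        using c by simp
      then show ?thesis
        using dissipation[of z 0] zero_le_power2[of "norm (C *v z)"]
        unfolding add_0_right inner_zero_right by linarith
    qed
  qed
  have "hinf_norm (transfer_matrix A C) \<le> ereal (c powr (- 1 / 2))"
    by (rule hinf_norm_le_if_dissipative[OF P_sym c(1) stable diss])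
  also have "\<dots> < ereal (\<eta>0 powr (- 1 / 2))"
    using c \<eta>0_pos by (simp add: powr_less_mono2_neg)
  finally have hinf: "hinf_norm (transfer_matrix A C) < ereal (\<eta>0 powr (- 1 / 2))" .

  have x_step: "x (Suc t) = A *v x t + w t" for t
    using state control
    by (simp add: A_def matrix_vector_mult_add_rdistrib flip: matrix_vector_mul_assoc)
  have x_bound: "x t \<bullet> (P *v x t) \<le> r0" for t
  proof -
    have "x (Suc t) \<bullet> (P *v x (Suc t)) \<le> x t \<bullet> (P *v x t) + (norm (w t))\<^sup>2 / \<eta>0" for t
    proof -
      have "(norm (w t))\<^sup>2 / c \<le> (norm (w t))\<^sup>2 / \<eta>0"
        using c \<eta>0_pos by (intro divide_left_mono) auto
      moreover have "0 \<le> (norm (C *v x t))\<^sup>2"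
        by simp
      ultimately show ?thesis
        using diss[of "x t" "w t"] unfolding x_step by linarith
    qed
    then have "x t \<bullet> (P *v x t) \<le> x 0 \<bullet> (P *v x 0) + (\<Sum>t. (norm (w t))\<^sup>2) / \<eta>0"
      by (rule storage_bounded[where s = "\<lambda>t. x t \<bullet> (P *v x t)"]) (use \<eta>0_pos w_summable in auto)
    also have "\<dots> \<le> x 0 \<bullet> (P *v x 0) + \<sigma>0 / \<eta>0"
      using w_bound \<eta>0_pos by (simp add: divide_right_mono)
    also have "\<sigma>0 / \<eta>0 = 1 / (inverse \<sigma>0 * \<eta>0)"
      by (simp add: field_simps)
    also have "x 0 \<bullet> (P *v x 0) + 1 / (inverse \<sigma>0 * \<eta>0) \<le> r0"
      unfolding P_def using \<sigma>0_pos \<eta>0_pos by (intro initial_state_bound[OF inv _ lmi3]) simp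
    finally show ?thesis .
  qed
  have "y2 t $ v \<le> y2max $ v" for v t
  proof -
    have "y2 t = (C2 ** Q0 + D2 ** Y0) *v (P *v x t)"
      using output2 control
      by (simp add: matrix_vector_mult_add_rdistrib QP K_mult flip: matrix_vector_mul_assoc)
    then show ?thesis
      using output_bound[OF inv r0_pos _ lmi4[rule_format], of v "x t"] x_bound y2max_nonneg
      by (simp add: P_def)
  qed
  then show ?thesis
    using stable hinf by (simp add: A_def C_def)
qed

end
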